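(* Let $\gamma\in(0,1]$ and suppose the $N$-agent constrained dynamic game with KKT residual $\mathcal{R}$ is $\gamma$-potential-dominant at $z_k$. Write $S(z_k)$ and $A(z_k)$ for the symmetric and skew-symmetric parts of the Jacobian $\nabla\mathcal{R}(z_k)$. Then the sequence $\{\Delta z_k^{(j)}\}$ generated by the iterative refinement scheme $$S(z_k)\,\Delta z_k^{(j+1)}=-\mathcal{R}(z_k)-A(z_k)\,\Delta z_k^{(j)}$$ converges linearly to the solution $\Delta z_k^*$ of the Newton system $\nabla\mathcal{R}(z_k)\,\Delta z_k^*=-\mathcal{R}(z_k)$. In particular, letting $e^{(j)}=\Delta z_k^{(j)}-\Delta z_k^*$, there exists a positive-definite matrix $P$ such that $$\|e^{(j)}\|_P\le\gamma^j\,\|e^{(0)}\|_P,$$ where $\|x\|_P^2=x^\top P x$. Additionally, the iteration complexity (the number of refinement iterations $j$ sufficient to achieve a desired error $\|e^{(j)}\|_P\le\varepsilon$) is given by $\mathcal{O}\!\left(\frac{\log(1/\varepsilon)}{\log(1/\gamma)}\right)$.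
   Context: Game: for each agent $i\in\{1,\dots,N\}$ with states $x^i_t\in\mathbb{R}^n$ and controls $u^i_t\in\mathbb{R}^m$, agent $i$ minimizes over $(x^i,u^i)$ the cost $\sum_{t=0}^{T}J^i_t(x_t,u^i_t)$ subject to the dynamics $x^i_{t+1}=f(x^i_t,u^i_t)$, $t=0,\dots,T-1$, and the shared constraint $h(x,u)\le 0$. Here $x_t$ is the concatenation of all agents' states at stage $t$, $x^i$ (resp. $u^i$) is the trajectory of agent $i$, and $x,u$ are the joint trajectories. Agent $i$'s Lagrangian is $\mathcal{L}^i=\sum_{t=0}^{T}J^i_t(x_t,u^i_t)+\mu^\top h(x,u)+\sum_{t=0}^{T-1}(\lambda^i_t)^\top[f(x^i_t,u^i_t)-x^i_{t+1}]$, where $\mu$ and $\lambda^i$ are the dual variables of the inequality constraints and of the dynamics. Let $\mathcal{F}^i(x^i,u^i)=0$ be the dynamics constraints of agent $i$ stacked over all stages, and $\mathcal{H}=h(x,u)$. Let $z=(z^1,\dots,z^N)$ where $z^i$ collects $x^i,u^i,\lambda^i,\mu$. The KKT residual is $\mathcal{R}=(\mathcal{R}^1,\dots,\mathcal{R}^N)$ with $\mathcal{R}^i=(\nabla_{x^i}\mathcal{L}^i,\nabla_{u^i}\mathcal{L}^i,\mathcal{F}^i,\mathcal{H})$, and $\nabla\mathcal{R}(z)$ is its (real, square) Jacobian, with blocks $\nabla_{z^j}\mathcal{R}^i$. Splitting: $\nabla\mathcal{R}(z)=S(z)+A(z)$ with $S(z)=\tfrac12\big(\nabla\mathcal{R}(z)+\nabla\mathcal{R}(z)^\top\big)$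 and $A(z)=\tfrac12\big(\nabla\mathcal{R}(z)-\nabla\mathcal{R}(z)^\top\big)$. Definition: for a given $\gamma\in(0,1]$, the game is $\gamma$-potential-dominant at $z$ if $S(z)$ is nonsingular and $\rho\big(S(z)^{-1}A(z)\big)<\gamma$, where $\rho$ denotes the spectral radius. The point $z_k$ is the current Newton iterate and is fixed throughout the refinement, which is indexed by $j\ge 0$ and starts from an initial vector $\Delta z_k^{(0)}$. *)

theory Defs
  imports
    "HOL-Analysis.Derivative"
    "HOL-Library.Landau_Symbols"
    "Jordan_Normal_Form.Spectral_Radius"
    "Jordan_Normal_Form.Gauss_Jordan_Elimination"
begin

section \<open>Linear algebra\<close>

definition sym_part :: "real mat \<Rightarrow> real mat" where
  "sym_part M = (1/2) \<cdot>\<^sub>m (M + transpose_mat M)"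

definition skew_part :: "real mat \<Rightarrow> real mat" where
  "skew_part M = (1/2) \<cdot>\<^sub>m (M - transpose_mat M)"

definition real_spectral_radius :: "real mat \<Rightarrow> real" where
  "real_spectral_radius M = spectral_radius (map_mat complex_of_real M)"

definition pos_def_mat :: "nat \<Rightarrow> real mat \<Rightarrow> bool" where
  "pos_def_mat d P \<longleftrightarrow> P \<in> carrier_mat d d \<and> transpose_mat P = P \<and>
     (\<forall>x \<in> carrier_vec d. x \<noteq> 0\<^sub>v d \<longrightarrow> scalar_prod x (P *\<^sub>v x) > 0)"

definition mat_norm :: "real mat \<Rightarrow> real vec \<Rightarrow> real" where
  "mat_norm P x = sqrt (scalar_prod x (P *\<^sub>v x))"

definition linear_rate :: "(real vec \<Rightarrow> real) \<Rightarrow> (nat \<Rightarrow> real vec) \<Rightarrow> bool" where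
  "linear_rate nrm e \<longleftrightarrow> (\<exists>q. 0 \<le> q \<and> q < 1 \<and> (\<forall>j. nrm (e (Suc j)) \<le> q * nrm (e j)))"


section \<open>Partial derivatives\<close>

definition has_partial :: "(real vec \<Rightarrow> real) \<Rightarrow> nat \<Rightarrow> real vec \<Rightarrow> bool" where
  "has_partial F k z \<longleftrightarrow> (\<lambda>s. F (z |\<^sub>v k \<mapsto> s)) differentiable (at (z $ k))"

definition partial_deriv :: "(real vec \<Rightarrow> real) \<Rightarrow> nat \<Rightarrow> real vec \<Rightarrow> real" where
  "partial_deriv F k z = deriv (\<lambda>s. F (z |\<^sub>v k \<mapsto> s)) (z $ k)"


section \<open>Dynamic games\<close>

text \<open>
  Agents are numbered from 0 to \<open>num_agents - 1\<close>; stages run from 0 to \<open>horizon\<close>. The cost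
  \<open>stage_cost G i t\<close> takes the concatenated state of all agents at stage \<open>t\<close> and the control of
  agent \<open>i\<close> at that stage. The shared constraint takes the joint state trajectory
  \<open>[x\<^sub>0, \<dots>, x\<^sub>T]\<close> and the joint control trajectory \<open>[u\<^sub>0, \<dots>, u\<^sub>T]\<close>, whose entries are the
  concatenations over all agents.
\<close>

record dyn_game =
  num_agents :: nat
  state_dim :: nat
  ctrl_dim :: nat
  num_constr :: nat
  horizon :: nat
  stage_cost :: "nat \<Rightarrow> nat \<Rightarrow> real vec \<Rightarrow> real vec \<Rightarrow> real"
  dyn :: "real vec \<Rightarrow> real vec \<Rightarrow> real vec"
  shared_constr :: "real vec list \<Rightarrow> real vec list \<Rightarrow> real vec"

definition joint_trajectories :: "nat \<Rightarrow> nat \<Rightarrow> real vec list set" where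
  "joint_trajectories d T = {xs. length xs = Suc T \<and> set xs \<subseteq> carrier_vec d}"

definition wf_game :: "dyn_game \<Rightarrow> bool" where
  "wf_game G \<longleftrightarrow> num_agents G > 0 \<and> state_dim G > 0 \<and> ctrl_dim G > 0 \<and>
     (\<forall>x \<in> carrier_vec (state_dim G). \<forall>u \<in> carrier_vec (ctrl_dim G).
        dyn G x u \<in> carrier_vec (state_dim G)) \<and>
     (\<forall>xs \<in> joint_trajectories (num_agents G * state_dim G) (horizon G).
      \<forall>us \<in> joint_trajectories (num_agents G * ctrl_dim G) (horizon G).
        shared_constr G xs us \<in> carrier_vec (num_constr G))"


subsection \<open>The KKT variable\<close>

text \<open>
  The multiplier \<open>\<mu>\<close> is shared by all agents and yet belongs to the variables of each of them. There
  are two ways to turn this into a square KKT system, and both are covered. With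
  \<open>Common_multiplier\<close>, \<open>\<mu>\<close> is one variable that occurs in every Lagrangian; it is listed once, in the
  block of agent 0, and so is the residual \<open>\<H>\<close>. With \<open>Multiplier_per_agent\<close>, every block has its own
  copy of \<open>\<mu>\<close>, used in the Lagrangian of that agent, and its own copy of \<open>\<H>\<close>. In the second case the
  copies of \<open>\<H>\<close> give equal rows of the Jacobian, which is therefore singular if there are at
  least two agents and at least one constraint.
\<close>

datatype mult_convention = Common_multiplier | Multiplier_per_agent

datatype coord =
    State_coord nat nat nat  \<comment> \<open>agent, stage, component\<close>
  | Ctrl_coord nat nat nat   \<comment> \<open>agent, stage, component\<close>
  | Dyn_mult nat nat nat     \<comment> \<open>agent, stage, component\<close>
  | Constr_mult nat nat      \<comment> \<open>owning agent, component\<close>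

definition mult_owner :: "mult_convention \<Rightarrow> nat \<Rightarrow> nat" where
  "mult_owner c i = (case c of Common_multiplier \<Rightarrow> 0 | Multiplier_per_agent \<Rightarrow> i)"

definition state_coords :: "dyn_game \<Rightarrow> nat \<Rightarrow> coord list" where
  "state_coords G i = [State_coord i t a. t \<leftarrow> [0..<Suc (horizon G)], a \<leftarrow> [0..<state_dim G]]"

definition ctrl_coords :: "dyn_game \<Rightarrow> nat \<Rightarrow> coord list" where
  "ctrl_coords G i = [Ctrl_coord i t a. t \<leftarrow> [0..<Suc (horizon G)], a \<leftarrow> [0..<ctrl_dim G]]"

definition dyn_mult_coords :: "dyn_game \<Rightarrow> nat \<Rightarrow> coord list" where
  "dyn_mult_coords G i = [Dyn_mult i t a. t \<leftarrow> [0..<horizon G], a \<leftarrow> [0..<state_dim G]]"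

definition constr_mult_coords :: "dyn_game \<Rightarrow> mult_convention \<Rightarrow> nat \<Rightarrow> coord list" where
  "constr_mult_coords G c i =
     (if mult_owner c i = i then map (Constr_mult i) [0..<num_constr G] else [])"

definition coords :: "dyn_game \<Rightarrow> mult_convention \<Rightarrow> coord list" where
  "coords G c = concat (map (\<lambda>i. state_coords G i @ ctrl_coords G i @ dyn_mult_coords G i @
     constr_mult_coords G c i) [0..<num_agents G])"

definition dim_kkt :: "dyn_game \<Rightarrow> mult_convention \<Rightarrow> nat" where
  "dim_kkt G c = length (coords G c)"

definition coord_pos :: "dyn_game \<Rightarrow> mult_convention \<Rightarrow> coord \<Rightarrow> nat" where
  "coord_pos G c q = (LEAST k. k < dim_kkt G c \<and> coords G c ! k = q)"

definition state_of :: "dyn_game \<Rightarrow> mult_convention \<Rightarrow> real vec \<Rightarrow> nat \<Rightarrow> nat \<Rightarrow> real vec" where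
  "state_of G c z i t = vec (state_dim G) (\<lambda>a. z $ coord_pos G c (State_coord i t a))"

definition ctrl_of :: "dyn_game \<Rightarrow> mult_convention \<Rightarrow> real vec \<Rightarrow> nat \<Rightarrow> nat \<Rightarrow> real vec" where
  "ctrl_of G c z i t = vec (ctrl_dim G) (\<lambda>a. z $ coord_pos G c (Ctrl_coord i t a))"

definition dyn_mult_of :: "dyn_game \<Rightarrow> mult_convention \<Rightarrow> real vec \<Rightarrow> nat \<Rightarrow> nat \<Rightarrow> real vec" where
  "dyn_mult_of G c z i t = vec (state_dim G) (\<lambda>a. z $ coord_pos G c (Dyn_mult i t a))"

definition constr_mult_of :: "dyn_game \<Rightarrow> mult_convention \<Rightarrow> real vec \<Rightarrow> nat \<Rightarrow> real vec" where
  "constr_mult_of G c z i =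
     vec (num_constr G) (\<lambda>b. z $ coord_pos G c (Constr_mult (mult_owner c i) b))"

definition joint_state :: "dyn_game \<Rightarrow> mult_convention \<Rightarrow> real vec \<Rightarrow> nat \<Rightarrow> real vec" where
  "joint_state G c z t =
     vec_of_list (concat (map (\<lambda>i. list_of_vec (state_of G c z i t)) [0..<num_agents G]))"

definition joint_ctrl :: "dyn_game \<Rightarrow> mult_convention \<Rightarrow> real vec \<Rightarrow> nat \<Rightarrow> real vec" where
  "joint_ctrl G c z t =
     vec_of_list (concat (map (\<lambda>i. list_of_vec (ctrl_of G c z i t)) [0..<num_agents G]))"


subsection \<open>Lagrangians and KKT residual\<close>

definition constr_at :: "dyn_game \<Rightarrow> mult_convention \<Rightarrow> real vec \<Rightarrow> real vec" where
  "constr_at G c z = shared_constr G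
     (map (joint_state G c z) [0..<Suc (horizon G)])
     (map (joint_ctrl G c z) [0..<Suc (horizon G)])"

definition dyn_defect :: "dyn_game \<Rightarrow> mult_convention \<Rightarrow> real vec \<Rightarrow> nat \<Rightarrow> nat \<Rightarrow> real vec" where
  "dyn_defect G c z i t =
     dyn G (state_of G c z i t) (ctrl_of G c z i t) - state_of G c z i (Suc t)"

definition lagrangian :: "dyn_game \<Rightarrow> mult_convention \<Rightarrow> nat \<Rightarrow> real vec \<Rightarrow> real" where
  "lagrangian G c i z =
     (\<Sum>t\<le>horizon G. stage_cost G i t (joint_state G c z t) (ctrl_of G c z i t))
     + scalar_prod (constr_mult_of G c z i) (constr_at G c z)
     + (\<Sum>t<horizon G. scalar_prod (dyn_mult_of G c z i t) (dyn_defect G c z i t))"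

definition lagrangian_grad ::
  "dyn_game \<Rightarrow> mult_convention \<Rightarrow> nat \<Rightarrow> coord list \<Rightarrow> real vec \<Rightarrow> real list" where
  "lagrangian_grad G c i qs z =
     map (\<lambda>q. partial_deriv (lagrangian G c i) (coord_pos G c q) z) qs"

definition agent_residual ::
  "dyn_game \<Rightarrow> mult_convention \<Rightarrow> nat \<Rightarrow> real vec \<Rightarrow> real list" where
  "agent_residual G c i z =
     lagrangian_grad G c i (state_coords G i) z
     @ lagrangian_grad G c i (ctrl_coords G i) z
     @ concat (map (\<lambda>t. list_of_vec (dyn_defect G c z i t)) [0..<horizon G])
     @ (if mult_owner c i = i then list_of_vec (constr_at G c z) else [])"

definition kkt_residual :: "dyn_game \<Rightarrow> mult_convention \<Rightarrow> real vec \<Rightarrow> real vec" where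
  "kkt_residual G c z =
     vec_of_list (concat (map (\<lambda>i. agent_residual G c i z) [0..<num_agents G]))"

definition kkt_jacobian :: "dyn_game \<Rightarrow> mult_convention \<Rightarrow> real vec \<Rightarrow> real mat" where
  "kkt_jacobian G c z = mat (dim_kkt G c) (dim_kkt G c)
     (\<lambda>(r, k). partial_deriv (\<lambda>w. kkt_residual G c w $ r) k z)"

text \<open>
  Existence of all derivatives that enter the Jacobian at \<open>z\<close>: those of the Lagrangians near \<open>z\<close>,
  and those of the residual at \<open>z\<close>. The operator \<^const>\<open>deriv\<close> has no meaningful value otherwise.
\<close>

definition kkt_differentiable_at :: "dyn_game \<Rightarrow> mult_convention \<Rightarrow> real vec \<Rightarrow> bool" where
  "kkt_differentiable_at G c z \<longleftrightarrow>
     (\<exists>\<delta>>0. \<forall>w \<in> carrier_vec (dim_kkt G c).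
        (\<forall>k < dim_kkt G c. \<bar>w $ k - z $ k\<bar> < \<delta>) \<longrightarrow>
        (\<forall>i < num_agents G. \<forall>q \<in> set (state_coords G i @ ctrl_coords G i).
           has_partial (lagrangian G c i) (coord_pos G c q) w)) \<and>
     (\<forall>r < dim_kkt G c. \<forall>k < dim_kkt G c. has_partial (\<lambda>w. kkt_residual G c w $ r) k z)"


subsection \<open>Potential dominance and iterative refinement\<close>

definition kkt_sym :: "dyn_game \<Rightarrow> mult_convention \<Rightarrow> real vec \<Rightarrow> real mat" where
  "kkt_sym G c z = sym_part (kkt_jacobian G c z)"

definition kkt_skew :: "dyn_game \<Rightarrow> mult_convention \<Rightarrow> real vec \<Rightarrow> real mat" where
  "kkt_skew G c z = skew_part (kkt_jacobian G c z)"

definition potential_dominant ::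
  "real \<Rightarrow> dyn_game \<Rightarrow> mult_convention \<Rightarrow> real vec \<Rightarrow> bool" where
  "potential_dominant \<gamma> G c z \<longleftrightarrow> invertible_mat (kkt_sym G c z) \<and>
     real_spectral_radius (the (mat_inverse (kkt_sym G c z)) * kkt_skew G c z) < \<gamma>"

definition refinement_seq ::
  "dyn_game \<Rightarrow> mult_convention \<Rightarrow> real vec \<Rightarrow> (nat \<Rightarrow> real vec) \<Rightarrow> bool" where
  "refinement_seq G c z dz \<longleftrightarrow> (\<forall>j. dz j \<in> carrier_vec (dim_kkt G c)) \<and>
     (\<forall>j. kkt_sym G c z *\<^sub>v dz (Suc j) = - kkt_residual G c z - kkt_skew G c z *\<^sub>v dz j)"

definition newton_step :: "dyn_game \<Rightarrow> mult_convention \<Rightarrow> real vec \<Rightarrow> real vec \<Rightarrow> bool" where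
  "newton_step G c z d \<longleftrightarrow> d \<in> carrier_vec (dim_kkt G c) \<and>
     kkt_jacobian G c z *\<^sub>v d = - kkt_residual G c z"


subsection \<open>The KKT system is square\<close>

lemma length_joint:
  "dim_vec (joint_state G c z t) = num_agents G * state_dim G"
  "dim_vec (joint_ctrl G c z t) = num_agents G * ctrl_dim G"
  by (simp_all add: joint_state_def joint_ctrl_def state_of_def ctrl_of_def length_concat
      o_def sum_list_triv)

lemma dim_constr_at:
  assumes "wf_game G"
  shows "dim_vec (constr_at G c z) = num_constr G"
proof -
  let ?xs = "map (joint_state G c z) [0..<Suc (horizon G)]"
  let ?us = "map (joint_ctrl G c z) [0..<Suc (horizon G)]"
  have "joint_state G c z t \<in> carrier_vec (num_agents G * state_dim G)"
    "joint_ctrl G c z t \<in> carrier_vec (num_agents G * ctrl_dim G)" for t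
    by (rule carrier_vecI, rule length_joint)+
  then have "?xs \<in> joint_trajectories (num_agents G * state_dim G) (horizon G)"
    "?us \<in> joint_trajectories (num_agents G * ctrl_dim G) (horizon G)"
    unfolding joint_trajectories_def mem_Collect_eq length_map length_upt set_map diff_zero
    by blast+
  then have "shared_constr G ?xs ?us \<in> carrier_vec (num_constr G)"
    using assms unfolding wf_game_def by blast
  then show ?thesis
    unfolding constr_at_def by (rule carrier_vecD)
qed

lemma dim_kkt_residual:
  assumes "wf_game G"
  shows "dim_vec (kkt_residual G c z) = dim_kkt G c"
proof -
  have "length (concat (map (\<lambda>t. list_of_vec (dyn_defect G c z i t)) [0..<horizon G])) =
      length (dyn_mult_coords G i)" for i
    unfolding dyn_mult_coords_def dyn_defect_def state_of_def length_concat map_map o_def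
      length_list_of_vec index_minus_vec dim_vec length_map length_upt diff_zero by (rule refl)
  then have "length (agent_residual G c i z) = length (state_coords G i @ ctrl_coords G i @
      dyn_mult_coords G i @ constr_mult_coords G c i)" for i
    unfolding agent_residual_def lagrangian_grad_def constr_mult_coords_def length_append
    by (simp only: length_map length_list_of_vec dim_constr_at[OF assms] length_upt diff_zero
        list.size(3) if_distrib[of length])
  then show ?thesis
    unfolding kkt_residual_def dim_kkt_def coords_def dim_vec_of_list length_concat map_map o_def
    by (simp only:)
qed

end

theory Submission
  imports Defs
begin

text \<open>
  The error satisfies \<open>e\<^sub>j\<^sub>+\<^sub>1 = - S\<^sup>-\<^sup>1 A e\<^sub>j\<close>. Pick \<open>q\<close> strictly between the spectral radius of
  \<open>M = S\<^sup>-\<^sup>1 A\<close> and \<open>\<gamma>\<close>; a discrete Lyapunov equation gives a positive definite \<open>P\<close> in whose norm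
  \<open>M\<close> contracts by \<open>q\<close>. The strict gap yields a linear rate even for \<open>\<gamma> = 1\<close>, and the contraction
  makes \<open>S + A = S (I + M)\<close> injective, so the Newton step exists and is unique.
\<close>

section \<open>Scaled matrices, spectral radius and growth of powers\<close>

lemma smult_pow_mat:
  fixes A :: "'a :: comm_semiring_1 mat"
  assumes "A \<in> carrier_mat n n"
  shows "(a \<cdot>\<^sub>m A) ^\<^sub>m k = a ^ k \<cdot>\<^sub>m (A ^\<^sub>m k)"
proof (induction k)
  case 0
  then show ?case by auto
next
  case (Suc k)
  have "A ^\<^sub>m k \<in> carrier_mat n n"
    using assms by simp
  then have "(a \<cdot>\<^sub>m A) ^\<^sub>m Suc k = a \<cdot>\<^sub>m (a ^ k \<cdot>\<^sub>m (A ^\<^sub>m k * A))"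
    using Suc assms
    by (simp add: mult_smult_assoc_mat[of _ n n _ n] mult_smult_distrib[of _ n n _ n])
  then show ?case
    by (auto simp: mult.assoc)
qed

lemma smult_mat_mult_vec:
  fixes A :: "'a :: comm_ring_1 mat"
  assumes "A \<in> carrier_mat nr nc" "v \<in> carrier_vec nc"
  shows "(a \<cdot>\<^sub>m A) *\<^sub>v v = a \<cdot>\<^sub>v (A *\<^sub>v v)"
  using assms by (intro eq_vecI) auto

text \<open>An eigenvector of the scaled matrix for \<open>ev\<close> is an eigenvector of
  \<open>A\<close> for \<open>r * ev\<close>, so \<open>r\<close> times the modulus of
  \<open>ev\<close> is at most the spectral radius of \<open>A\<close>. Positive size ensures that
  the spectrum is nonempty and the maximum attained.\<close>

lemma spectral_radius_scaled_less_1: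
  assumes A: "A \<in> carrier_mat n n" and n: "n > 0" and r: "0 < r" "spectral_radius A < r"
  shows "spectral_radius (complex_of_real (1 / r) \<cdot>\<^sub>m A) < 1"
proof -
  let ?B = "complex_of_real (1 / r) \<cdot>\<^sub>m A"
  have B: "?B \<in> carrier_mat n n"
    using A by simp
  obtain ev where ev: "ev \<in> spectrum ?B" "spectral_radius ?B = norm ev"
    using spectral_radius_mem_max(1)[OF B n] by auto
  then obtain v where v: "v \<in> carrier_vec n" "v \<noteq> 0\<^sub>v n" "?B *\<^sub>v v = ev \<cdot>\<^sub>v v"
    using A unfolding spectrum_def eigenvalue_def eigenvector_def by auto
  have "A = complex_of_real r \<cdot>\<^sub>m ?B"
    using r by (intro eq_matI) auto
  then have "A *\<^sub>v v = complex_of_real r \<cdot>\<^sub>v (?B *\<^sub>v v)"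
    using smult_mat_mult_vec[OF B v(1)] by metis
  then have "A *\<^sub>v v = (complex_of_real r * ev) \<cdot>\<^sub>v v"
    unfolding v(3) by (simp add: smult_smult_assoc)
  then have "complex_of_real r * ev \<in> spectrum A"
    using A v(1,2) unfolding spectrum_def eigenvalue_def eigenvector_def by auto
  then have "norm (complex_of_real r * ev) \<le> spectral_radius A"
    using spectral_radius_mem_max(2)[OF A n] by blast
  moreover have "norm (complex_of_real r * ev) = r * norm ev"
    using r(1) by (simp add: norm_mult)
  ultimately have "r * norm ev < r * 1"
    using r(2) by linarith
  then show ?thesis
    using ev(2) r(1) by (metis mult_less_cancel_left_pos)
qed

text \<open>Dividing by \<open>r\<close> brings the spectral radius below 1, where the powers of a
  complex matrix stay bounded; undoing the scaling turns the constant bound into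
  \<open>C * r ^ k\<close>. Size 0 is split off because its spectrum is empty.\<close>

lemma pow_mat_entry_bound:
  assumes M: "M \<in> carrier_mat n n" and r: "0 < r" "real_spectral_radius M < r"
  obtains C where "\<And>k i j. i < n \<Longrightarrow> j < n \<Longrightarrow> \<bar>(M ^\<^sub>m k) $$ (i, j)\<bar> \<le> C * r ^ k"
proof (cases "n = 0")
  case True
  then show ?thesis using that by simp
next
  case False
  let ?A = "map_mat complex_of_real M"
  let ?B = "complex_of_real (1 / r) \<cdot>\<^sub>m ?A"
  have A: "?A \<in> carrier_mat n n" and B: "?B \<in> carrier_mat n n"
    using M by simp_all
  have "spectral_radius ?B < 1"
    using spectral_radius_scaled_less_1[OF A _ r(1)] r(2) False
    unfolding real_spectral_radius_def by blast
  from spectral_radius_jnf_norm_bound_less_1_upper_triangular[OF B this]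
  obtain C where C: "\<And>k. norm_bound (?B ^\<^sub>m k) C"
    by blast
  show ?thesis
  proof (rule that)
    fix k i j
    assume ij: "i < n" "j < n"
    have Mk: "M ^\<^sub>m k \<in> carrier_mat n n" and Ak: "?A ^\<^sub>m k \<in> carrier_mat n n"
      and Bk: "?B ^\<^sub>m k \<in> carrier_mat n n"
      using M A B by simp_all
    have Ak_eq: "?A ^\<^sub>m k = map_mat complex_of_real (M ^\<^sub>m k)"
      by (rule of_real_hom.mat_hom_pow[OF M, symmetric])
    have "norm ((?B ^\<^sub>m k) $$ (i, j)) \<le> C"
      using C[of k] carrier_matD[OF Bk] ij unfolding norm_bound_def by metis
    moreover have "(?B ^\<^sub>m k) $$ (i, j) = complex_of_real ((1 / r) ^ k * (M ^\<^sub>m k) $$ (i, j))"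
      unfolding smult_pow_mat[OF A] Ak_eq using carrier_matD[OF Mk] ij
      by (simp del: pow_mat_dim)
    ultimately have "\<bar>(1 / r) ^ k * (M ^\<^sub>m k) $$ (i, j)\<bar> \<le> C"
      by (simp only: norm_of_real)
    then show "\<bar>(M ^\<^sub>m k) $$ (i, j)\<bar> \<le> C * r ^ k"
      using r(1) by (simp add: abs_mult power_one_over field_simps)
  qed
qed

section \<open>Quadratic forms and Gram matrices\<close>

lemma quadratic_form_eq_sum:
  fixes N :: "real mat"
  assumes "N \<in> carrier_mat n n" "x \<in> carrier_vec n"
  shows "scalar_prod x (N *\<^sub>v x) = (\<Sum>i<n. \<Sum>j<n. x $ i * (N $$ (i, j) * x $ j))"
proof -
  have "scalar_prod x (N *\<^sub>v x) = (\<Sum>i<n. x $ i * (\<Sum>j<n. N $$ (i, j) * x $ j))"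
    using assms by (auto simp: scalar_prod_def lessThan_atLeast0 intro!: sum.cong)
  then show ?thesis
    by (simp add: sum_distrib_left)
qed

lemma scalar_prod_self_nonneg: "scalar_prod x x \<ge> (0 :: real)"
  unfolding scalar_prod_def by (intro sum_nonneg) auto

lemma power2_index_le_scalar_prod_self:
  fixes x :: "real vec"
  assumes "x \<in> carrier_vec n" "i < n"
  shows "(x $ i)\<^sup>2 \<le> scalar_prod x x"
proof -
  have "x $ i * x $ i \<le> (\<Sum>i = 0..<n. x $ i * x $ i)"
    using assms(2) by (intro member_le_sum) auto
  then show ?thesis
    using assms(1) by (simp add: scalar_prod_def power2_eq_square)
qed

lemma scalar_prod_self_pos:
  fixes x :: "real vec"
  assumes "x \<in> carrier_vec n" "x \<noteq> 0\<^sub>v n"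
  shows "scalar_prod x x > 0"
proof -
  obtain i where "i < n" "x $ i \<noteq> 0"
    using assms by (metis carrier_vecD eq_vecI index_zero_vec)
  then show ?thesis
    using power2_index_le_scalar_prod_self[OF assms(1), of i]
    by (smt (verit) zero_less_power2)
qed

lemma gram_carrier: "B \<in> carrier_mat m n \<Longrightarrow> transpose_mat B * B \<in> carrier_mat n n"
  by simp

lemma gram_index:
  assumes "B \<in> carrier_mat m n" "i < n" "j < n"
  shows "(transpose_mat B * B) $$ (i, j) = (\<Sum>l<m. B $$ (l, i) * B $$ (l, j))"
  using assms by (auto simp: scalar_prod_def lessThan_atLeast0)

section \<open>Lyapunov equation and adapted norm\<close>

text \<open>
  The solution \<open>P = \<Sum>k. q\<^sup>-\<^sup>2\<^sup>k (M\<^sup>k)\<^sup>T M\<^sup>k\<close> of the discrete Lyapunov equation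
  \<open>P - q\<^sup>-\<^sup>2 M\<^sup>T P M = I\<close>.
\<close>

lemma discrete_lyapunov:
  assumes M: "M \<in> carrier_mat n n" and q: "0 < q" "real_spectral_radius M < q"
  obtains P where "P \<in> carrier_mat n n" "transpose_mat P = P"
    "\<And>x. x \<in> carrier_vec n \<Longrightarrow> scalar_prod x x \<le> scalar_prod x (P *\<^sub>v x)"
    "\<And>x. x \<in> carrier_vec n \<Longrightarrow>
      scalar_prod (M *\<^sub>v x) (P *\<^sub>v (M *\<^sub>v x)) = q\<^sup>2 * (scalar_prod x (P *\<^sub>v x) - scalar_prod x x)"
proof -
  \<comment> \<open>A second gap, below \<open>q\<close>: powers of \<open>M\<close> grow at most
    like \<open>r ^ k\<close>, so the weights \<open>(1 / q\<^sup>2) ^ k\<close> leave a geometric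
    series of ratio \<open>r\<^sup>2 / q\<^sup>2\<close>. The maximum with 0 keeps \<open>r\<close>
    positive even if the spectral radius is 0.\<close>
  obtain r where r: "0 < r" "real_spectral_radius M < r" "r < q"
    using dense[of "max 0 (real_spectral_radius M)" q] q by auto
  obtain C where C: "\<And>k i j. i < n \<Longrightarrow> j < n \<Longrightarrow> \<bar>(M ^\<^sub>m k) $$ (i, j)\<bar> \<le> C * r ^ k"
    using pow_mat_entry_bound[OF M r(1,2)] by blast
  define N where "N k = (1 / q\<^sup>2) ^ k \<cdot>\<^sub>m (transpose_mat (M ^\<^sub>m k) * M ^\<^sub>m k)" for k
  define P where "P = mat n n (\<lambda>(i, j). \<Sum>k. N k $$ (i, j))"
  have Mk: "M ^\<^sub>m k \<in> carrier_mat n n" for k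
    using M by simp
  have N: "N k \<in> carrier_mat n n" for k
    unfolding N_def using Mk[of k] by simp
  have P: "P \<in> carrier_mat n n"
    unfolding P_def by simp
  have N_entry: "N k $$ (i, j) = (1 / q\<^sup>2) ^ k * (\<Sum>l<n. (M ^\<^sub>m k) $$ (l, i) * (M ^\<^sub>m k) $$ (l, j))"
    if "i < n" "j < n" for k i j
    unfolding N_def using gram_index[OF Mk that, of k] carrier_matD[OF gram_carrier[OF Mk, of k]] that by simp
  \<comment> \<open>Each of the \<open>n\<close> products in a Gram entry is bounded by the square
    of \<open>C * r ^ k\<close>, which gives the geometric majorant.\<close>
  have N_summable: "summable (\<lambda>k. N k $$ (i, j))" if ij: "i < n" "j < n" for i j
  proof (rule summable_comparison_test')
    show "summable (\<lambda>k. real n * C\<^sup>2 * (r\<^sup>2 / q\<^sup>2) ^ k)"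
      using r q by (intro summable_mult summable_geometric) (simp add: power_strict_mono)
    fix k
    have "\<bar>(M ^\<^sub>m k) $$ (l, i) * (M ^\<^sub>m k) $$ (l, j)\<bar> \<le> (C * r ^ k) * (C * r ^ k)" if "l < n" for l
      unfolding abs_mult using C[OF that ij(1), of k] C[OF that ij(2), of k]
      by (intro mult_mono) auto
    then have "\<bar>\<Sum>l<n. (M ^\<^sub>m k) $$ (l, i) * (M ^\<^sub>m k) $$ (l, j)\<bar> \<le> (\<Sum>l<n. (C * r ^ k) * (C * r ^ k))"
      by (intro order_trans[OF sum_abs] sum_mono) auto
    then have "(1 / q\<^sup>2) ^ k * \<bar>\<Sum>l<n. (M ^\<^sub>m k) $$ (l, i) * (M ^\<^sub>m k) $$ (l, j)\<bar>
        \<le> (1 / q\<^sup>2) ^ k * (real n * ((C * r ^ k) * (C * r ^ k)))"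
      by (intro mult_left_mono) auto
    also have "\<dots> = real n * C\<^sup>2 * (r\<^sup>2 / q\<^sup>2) ^ k"
      by (simp add: power2_eq_square power_divide power_mult_distrib)
    finally show "norm (N k $$ (i, j)) \<le> real n * C\<^sup>2 * (r\<^sup>2 / q\<^sup>2) ^ k"
      unfolding N_entry[OF ij] by (simp add: abs_mult)
  qed
  have P_sym: "transpose_mat P = P"
  proof (rule eq_matI)
    fix i j
    assume "i < dim_row P" "j < dim_col P"
    then have ij: "i < n" "j < n"
      using P by auto
    then show "transpose_mat P $$ (i, j) = P $$ (i, j)"
      unfolding P_def by (simp add: N_entry mult.commute)
  qed (use P in auto)
  \<comment> \<open>The quadratic form of \<open>P\<close> is a finite combination of its entries,
    so it may be summed term by term; the form of \<open>N k\<close> is the weighted squared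
    Euclidean length of \<open>M ^\<^sub>m k *\<^sub>v x\<close>.\<close>
  have form_sums: "(\<lambda>k. (1 / q\<^sup>2) ^ k * scalar_prod (M ^\<^sub>m k *\<^sub>v x) (M ^\<^sub>m k *\<^sub>v x))
      sums scalar_prod x (P *\<^sub>v x)" if x: "x \<in> carrier_vec n" for x
  proof -
    have "(\<lambda>k. \<Sum>i<n. \<Sum>j<n. x $ i * (N k $$ (i, j) * x $ j))
        sums (\<Sum>i<n. \<Sum>j<n. x $ i * (P $$ (i, j) * x $ j))"
      by (intro sums_sum sums_mult sums_mult2) (auto simp: P_def intro!: summable_sums N_summable)
    moreover have "(\<Sum>i<n. \<Sum>j<n. x $ i * (N k $$ (i, j) * x $ j)) =
        (1 / q\<^sup>2) ^ k * scalar_prod (M ^\<^sub>m k *\<^sub>v x) (M ^\<^sub>m k *\<^sub>v x)" for k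
    proof -
      have "scalar_prod (M ^\<^sub>m k *\<^sub>v x) (M ^\<^sub>m k *\<^sub>v x) =
          scalar_prod (transpose_mat (M ^\<^sub>m k) *\<^sub>v (M ^\<^sub>m k *\<^sub>v x)) x"
        using transpose_vec_mult_scalar[OF Mk[of k] x, of "M ^\<^sub>m k *\<^sub>v x"] Mk[of k] x
        by (simp add: comm_scalar_prod[of _ n])
      also have "\<dots> = scalar_prod x ((transpose_mat (M ^\<^sub>m k) * M ^\<^sub>m k) *\<^sub>v x)"
        using Mk[of k] x by (simp add: comm_scalar_prod[of _ n] assoc_mult_mat_vec[of _ n n _ n])
      finally have "(1 / q\<^sup>2) ^ k * scalar_prod (M ^\<^sub>m k *\<^sub>v x) (M ^\<^sub>m k *\<^sub>v x) =
          scalar_prod x (N k *\<^sub>v x)"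
        unfolding N_def using Mk[of k] x
        by (simp add: smult_mat_mult_vec[of _ n n] scalar_prod_smult_distrib[of _ n])
      then show ?thesis
        unfolding quadratic_form_eq_sum[OF N x] by simp
    qed
    ultimately show ?thesis
      unfolding quadratic_form_eq_sum[OF P x] by simp
  qed
  \<comment> \<open>Index shift: since the power of order \<open>Suc k\<close> is
    \<open>M ^\<^sub>m k * M\<close>, the series at \<open>x\<close> without its first term is
    \<open>1 / q\<^sup>2\<close> times the series at \<open>M *\<^sub>v x\<close>. Uniqueness of the
    sum gives the equation.\<close>
  have lyap: "scalar_prod (M *\<^sub>v x) (P *\<^sub>v (M *\<^sub>v x)) = q\<^sup>2 * (scalar_prod x (P *\<^sub>v x) - scalar_prod x x)"
    if x: "x \<in> carrier_vec n" for x
  proof -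
    let ?f = "\<lambda>k. (1 / q\<^sup>2) ^ k * scalar_prod (M ^\<^sub>m k *\<^sub>v x) (M ^\<^sub>m k *\<^sub>v x)"
    have Mx: "M *\<^sub>v x \<in> carrier_vec n"
      using M x by simp
    have "(\<lambda>k. ?f (Suc k)) sums (scalar_prod x (P *\<^sub>v x) - ?f 0)"
      using form_sums[OF x] by (subst sums_Suc_iff) simp
    moreover have "?f 0 = scalar_prod x x"
      using M x by simp
    ultimately have "(\<lambda>k. ?f (Suc k)) sums (scalar_prod x (P *\<^sub>v x) - scalar_prod x x)"
      by (simp only:)
    moreover have "(\<lambda>k. ?f (Suc k)) sums (1 / q\<^sup>2 * scalar_prod (M *\<^sub>v x) (P *\<^sub>v (M *\<^sub>v x)))"
      using sums_mult[OF form_sums[OF Mx], of "1 / q\<^sup>2"]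
      by (simp add: assoc_mult_mat_vec[OF Mk M x] mult.assoc)
    ultimately have "1 / q\<^sup>2 * scalar_prod (M *\<^sub>v x) (P *\<^sub>v (M *\<^sub>v x)) =
        scalar_prod x (P *\<^sub>v x) - scalar_prod x x"
      by (rule sums_unique2[symmetric])
    then show ?thesis
      using q(1) by (simp add: field_simps)
  qed
  \<comment> \<open>The left side of \<open>lyap\<close> is a sum of nonnegative terms, so the
    bracket on its right side is nonnegative as well.\<close>
  have "scalar_prod x x \<le> scalar_prod x (P *\<^sub>v x)" if x: "x \<in> carrier_vec n" for x
  proof -
    have "0 \<le> scalar_prod (M *\<^sub>v x) (P *\<^sub>v (M *\<^sub>v x))"
      using M x by (intro sums_le[OF _ sums_zero form_sums]) (auto simp: scalar_prod_self_nonneg)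
    then show ?thesis
      unfolding lyap[OF x] using q(1) by (simp add: zero_le_mult_iff)
  qed
  then show ?thesis
    using that P P_sym lyap by blast
qed

text \<open>Discarding the nonpositive term \<open>- scalar_prod x x\<close> in the Lyapunov
  equation leaves a contraction by \<open>q\<close>. That the form of \<open>P\<close> dominates the
  Euclidean one gives both definiteness and the bound on entries, by which decay in this norm yields
  convergence of every component.\<close>

lemma adapted_norm:
  assumes M: "M \<in> carrier_mat n n" and q: "0 < q" "real_spectral_radius M < q"
  obtains P where "pos_def_mat n P"
    "\<And>x i. x \<in> carrier_vec n \<Longrightarrow> i < n \<Longrightarrow> \<bar>x $ i\<bar> \<le> mat_norm P x"
    "\<And>x. x \<in> carrier_vec n \<Longrightarrow> mat_norm P (M *\<^sub>v x) \<le> q * mat_norm P x"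
proof -
  obtain P where P: "P \<in> carrier_mat n n" "transpose_mat P = P"
    and ge: "\<And>x. x \<in> carrier_vec n \<Longrightarrow> scalar_prod x x \<le> scalar_prod x (P *\<^sub>v x)"
    and lyap: "\<And>x. x \<in> carrier_vec n \<Longrightarrow>
      scalar_prod (M *\<^sub>v x) (P *\<^sub>v (M *\<^sub>v x)) = q\<^sup>2 * (scalar_prod x (P *\<^sub>v x) - scalar_prod x x)"
    using discrete_lyapunov[OF M q] by blast
  show ?thesis
  proof (rule that)
    show "pos_def_mat n P"
      unfolding pos_def_mat_def using P scalar_prod_self_pos ge by (auto intro: less_le_trans)
  next
    fix x :: "real vec" and i
    assume "x \<in> carrier_vec n" "i < n"
    then have "(x $ i)\<^sup>2 \<le> scalar_prod x (P *\<^sub>v x)"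
      using power2_index_le_scalar_prod_self ge order_trans by blast
    then show "\<bar>x $ i\<bar> \<le> mat_norm P x"
      unfolding mat_norm_def by (metis real_sqrt_abs real_sqrt_le_mono)
  next
    fix x :: "real vec"
    assume x: "x \<in> carrier_vec n"
    have "scalar_prod (M *\<^sub>v x) (P *\<^sub>v (M *\<^sub>v x)) \<le> q\<^sup>2 * scalar_prod x (P *\<^sub>v x)"
      unfolding lyap[OF x] by (intro mult_left_mono) (auto simp: scalar_prod_self_nonneg)
    then have "mat_norm P (M *\<^sub>v x) \<le> sqrt (q\<^sup>2 * scalar_prod x (P *\<^sub>v x))"
      unfolding mat_norm_def by (rule real_sqrt_le_mono)
    then show "mat_norm P (M *\<^sub>v x) \<le> q * mat_norm P x"
      unfolding mat_norm_def using q(1) by (simp add: real_sqrt_mult)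
  qed
qed

section \<open>Linear systems and the symmetric-skew splitting\<close>

lemma mat_norm_uminus:
  assumes "P \<in> carrier_mat n n" "x \<in> carrier_vec n"
  shows "mat_norm P (- x) = mat_norm P x"
proof -
  have "P *\<^sub>v (- x) = - (P *\<^sub>v x)"
    using assms by (intro eq_vecI) auto
  then show ?thesis
    unfolding mat_norm_def using assms by simp
qed

lemma sym_part_plus_skew_part:
  assumes "J \<in> carrier_mat n n"
  shows "sym_part J + skew_part J = J"
  unfolding sym_part_def skew_part_def using assms by (intro eq_matI) (auto simp: field_simps)

text \<open>Connects abstract invertibility with the computed inverse through the units of the
  matrix ring.\<close>

lemma inverse_of_invertible_mat:
  fixes S :: "'a :: field mat"
  assumes S: "S \<in> carrier_mat n n" and "invertible_mat S"
  shows "the (mat_inverse S) \<in> carrier_mat n n" "the (mat_inverse S) * S = 1\<^sub>m n"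
proof -
  obtain B where B: "S * B = 1\<^sub>m n" "B * S = 1\<^sub>m (dim_row B)"
    using assms unfolding invertible_mat_def inverts_mat_def by auto
  \<comment> \<open>\<open>invertible_mat\<close> does not fix the size of \<open>B\<close>; it is
    read off from the dimensions of the two products.\<close>
  have "dim_col B = n" "dim_row B = n"
    using S arg_cong[OF B(1), of dim_col] arg_cong[OF B(2), of dim_col] by auto
  then have "S \<in> Units (ring_mat TYPE('a) n ())"
    using S B unfolding Units_def ring_mat_def by auto
  then obtain T where T: "mat_inverse S = Some T"
    using mat_inverse(1)[OF S, of "()"] by (cases "mat_inverse S") auto
  show "the (mat_inverse S) \<in> carrier_mat n n" "the (mat_inverse S) * S = 1\<^sub>m n"
    using mat_inverse(2)[OF S T] T by auto
qed

lemma injective_mat_ex1_solution: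
  fixes J :: "'a :: field mat"
  assumes J: "J \<in> carrier_mat n n" and b: "b \<in> carrier_vec n"
    and inj: "\<And>v. v \<in> carrier_vec n \<Longrightarrow> J *\<^sub>v v = 0\<^sub>v n \<Longrightarrow> v = 0\<^sub>v n"
  shows "\<exists>!d. d \<in> carrier_vec n \<and> J *\<^sub>v d = b"
proof -
  have "det J \<noteq> 0"
    using det_0_iff_vec_prod_zero_field[OF J] inj by blast
  then obtain B where B: "B \<in> carrier_mat n n" "B * J = 1\<^sub>m n" "J * B = 1\<^sub>m n"
    using det_non_zero_imp_unit[OF J, of "()"] unfolding Units_def ring_mat_def by auto
  have "J *\<^sub>v (B *\<^sub>v b) = b"
    using assoc_mult_mat_vec[OF J B(1) b] B(3) b by simp
  moreover have "d = B *\<^sub>v b" if "d \<in> carrier_vec n" "J *\<^sub>v d = b" for d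
    using assoc_mult_mat_vec[OF B(1) J that(1)] B(2) that by simp
  ultimately show ?thesis
    using mult_mat_vec_carrier[OF B(1) b] by blast
qed

text \<open>Subtract \<open>S *\<^sub>v d = b - A *\<^sub>v d\<close> from the step and apply the
  left inverse \<open>T\<close>.\<close>

lemma splitting_error_step:
  fixes S A :: "real mat"
  assumes S: "S \<in> carrier_mat n n" and A: "A \<in> carrier_mat n n"
    and T: "T \<in> carrier_mat n n" "T * S = 1\<^sub>m n"
    and x: "x \<in> carrier_vec n" and y: "y \<in> carrier_vec n" and d: "d \<in> carrier_vec n"
    and step: "S *\<^sub>v y = b - A *\<^sub>v x" and sol: "(S + A) *\<^sub>v d = b"
  shows "y - d = - ((T * A) *\<^sub>v (x - d))"
proof -
  have "S *\<^sub>v (y - d) = (b - A *\<^sub>v x) - S *\<^sub>v d"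
    using mult_minus_distrib_mat_vec[OF S y d] step by simp
  also have "\<dots> = - (A *\<^sub>v (x - d))"
    unfolding sol[symmetric] add_mult_distrib_mat_vec[OF S A d]
      mult_minus_distrib_mat_vec[OF A x d]
    using S A x d by (intro eq_vecI) auto
  finally have "T *\<^sub>v (S *\<^sub>v (y - d)) = T *\<^sub>v (- (A *\<^sub>v (x - d)))"
    by simp
  moreover have "T *\<^sub>v (S *\<^sub>v (y - d)) = y - d"
    using assoc_mult_mat_vec[OF T(1) S, of "y - d"] T(2) y d by simp
  moreover have "T *\<^sub>v (- (A *\<^sub>v (x - d))) = - (T *\<^sub>v (A *\<^sub>v (x - d)))"
    using T A x d by (intro eq_vecI) auto
  moreover have "T *\<^sub>v (A *\<^sub>v (x - d)) = (T * A) *\<^sub>v (x - d)"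
    using assoc_mult_mat_vec[OF T(1) A, of "x - d"] x d by simp
  ultimately show ?thesis
    by simp
qed

section \<open>Number of iterations for a geometric bound\<close>

text \<open>\<open>K\<close> solves \<open>\<gamma> ^ j * b \<le> \<epsilon>\<close> for
  \<open>j\<close> and rounds up. The initial size and the rounding add only a constant, which any
  factor \<open>C > 1\<close> absorbs as \<open>\<epsilon>\<close> tends to 0; so the leading
  constant is arbitrarily close to 1.\<close>

lemma geometric_iteration_complexity:
  fixes v :: "nat \<Rightarrow> real"
  assumes \<gamma>: "0 < \<gamma>" "\<gamma> < 1" and v: "\<And>j. v j \<le> \<gamma> ^ j * a"
  shows "\<exists>K :: real \<Rightarrow> nat. (\<forall>\<epsilon>>0. \<forall>j \<ge> K \<epsilon>. v j \<le> \<epsilon>) \<and>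
    (\<lambda>\<epsilon>. real (K \<epsilon>)) \<in> O[at_right 0](\<lambda>\<epsilon>. ln (1 / \<epsilon>) / ln (1 / \<gamma>)) \<and>
    (\<forall>C>1. \<forall>\<^sub>F \<epsilon> in at_right 0. real (K \<epsilon>) \<le> C * (ln (1 / \<epsilon>) / ln (1 / \<gamma>)))"
proof -
  \<comment> \<open>Raising \<open>a\<close> to at least 1 makes its logarithm meaningful and
    nonnegative, also if \<open>a\<close> is 0 or negative.\<close>
  define b where "b = max 1 a"
  define L where "L = ln (1 / \<gamma>)"
  define K where "K \<epsilon> = nat \<lceil>ln (b / \<epsilon>) / L\<rceil>" for \<epsilon>
  have b: "b \<ge> 1" "a \<le> b" and L: "L > 0"
    unfolding b_def L_def using \<gamma> by auto
  have suff: "v j \<le> \<epsilon>" if "\<epsilon> > 0" "j \<ge> K \<epsilon>" for \<epsilon> j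
  proof -
    have "ln (b / \<epsilon>) / L \<le> real j"
      using that(2) unfolding K_def by linarith
    then have "ln (b / \<epsilon>) \<le> real j * L"
      using L by (simp add: field_simps)
    also have "\<dots> = ln ((1 / \<gamma>) ^ j)"
      unfolding L_def using \<gamma> by (simp add: ln_realpow)
    finally have "b / \<epsilon> \<le> (1 / \<gamma>) ^ j"
      using b \<gamma> that(1) by simp
    then have "\<gamma> ^ j * b \<le> \<epsilon>"
      using \<gamma> that(1) by (simp add: power_one_over field_simps)
    moreover have "\<gamma> ^ j * a \<le> \<gamma> ^ j * b"
      using \<gamma> b by (intro mult_left_mono) auto
    ultimately show ?thesis
      using v[of j] by linarith
  qed
  have asymp: "\<forall>\<^sub>F \<epsilon> in at_right 0. real (K \<epsilon>) \<le> C * (ln (1 / \<epsilon>) / L)" if C: "C > 1" for C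
  proof -
    \<comment> \<open>Chosen so that \<open>ln (1 / \<epsilon>) \<ge> c\<close> makes the surplus
      \<open>(C - 1) * ln (1 / \<epsilon>)\<close> cover \<open>ln b\<close> and one further
      \<open>L\<close>, the cost of rounding up.\<close>
    define c where "c = (ln b + L) / (C - 1)"
    have c: "c * (C - 1) = ln b + L"
      unfolding c_def using C by simp
    have "\<forall>\<^sub>F \<epsilon> :: real in at_right 0. \<epsilon> \<in> {0<..<min 1 (exp (- c))}"
      by (intro eventually_at_right_real) simp
    then show ?thesis
    proof eventually_elim
      case (elim \<epsilon>)
      then have \<epsilon>: "0 < \<epsilon>" "\<epsilon> < 1" "\<epsilon> < exp (- c)"
        by auto
      then have "ln \<epsilon> < - c"
        by (metis ln_exp ln_less_cancel_iff exp_gt_zero)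
      then have "c * (C - 1) \<le> ln (1 / \<epsilon>) * (C - 1)"
        using \<epsilon> C by (intro mult_right_mono) (auto simp: ln_div)
      then have "ln b + L + ln (1 / \<epsilon>) \<le> C * ln (1 / \<epsilon>)"
        using c by (simp add: algebra_simps)
      then have "(ln b + L + ln (1 / \<epsilon>)) / L \<le> C * ln (1 / \<epsilon>) / L"
        using L by (intro divide_right_mono) auto
      then have le: "ln (b / \<epsilon>) / L + 1 \<le> C * (ln (1 / \<epsilon>) / L)"
        using b \<epsilon> L by (simp add: ln_div add_divide_distrib diff_divide_distrib)
      \<comment> \<open>\<open>nat\<close> truncates at 0, so the bound by the quotient plus one
        needs a quotient that is not too negative.\<close>
      have "0 \<le> ln (b / \<epsilon>) / L"
        using b \<epsilon> L by simp
      then have "real (K \<epsilon>) \<le> ln (b / \<epsilon>) / L + 1"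
        unfolding K_def by linarith
      then show ?case
        using le by linarith
    qed
  qed
  have "\<forall>\<^sub>F \<epsilon> in at_right 0. norm (real (K \<epsilon>)) \<le> 2 * norm (ln (1 / \<epsilon>) / L)"
  \<comment> \<open>Any constant above 1 would serve for the Landau bound.\<close>
  proof (rule eventually_mono[OF asymp[of 2]])
    show "norm (real (K \<epsilon>)) \<le> 2 * norm (ln (1 / \<epsilon>) / L)"
      if "real (K \<epsilon>) \<le> 2 * (ln (1 / \<epsilon>) / L)" for \<epsilon>
      using that abs_ge_self[of "ln (1 / \<epsilon>) / L"] unfolding real_norm_def by linarith
  qed simp
  then have "(\<lambda>\<epsilon>. real (K \<epsilon>)) \<in> O[at_right 0](\<lambda>\<epsilon>. ln (1 / \<epsilon>) / L)"
    by (rule bigoI)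
  then show ?thesis
    using suff asymp unfolding L_def by blast
qed

section \<open>Newton step and convergence of the refinement\<close>

theorem theorem3:
  fixes G :: dyn_game and c :: mult_convention and \<gamma> :: real and zk :: "real vec"
  assumes "wf_game G"
    and "0 < \<gamma>" and "\<gamma> \<le> 1"
    and "zk \<in> carrier_vec (dim_kkt G c)"
    and "kkt_differentiable_at G c zk"
    and "potential_dominant \<gamma> G c zk"
  shows "\<exists>dz_star. newton_step G c zk dz_star \<and> (\<forall>d. newton_step G c zk d \<longrightarrow> d = dz_star) \<and>
    (\<exists>P. pos_def_mat (dim_kkt G c) P \<and>
      (\<forall>dz. refinement_seq G c zk dz \<longrightarrow>
        (let e = (\<lambda>j. dz j - dz_star) in
          (\<forall>k < dim_kkt G c. (\<lambda>j. dz j $ k) \<longlonglongrightarrow> dz_star $ k) \<and>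
          linear_rate (mat_norm P) e \<and>
          (\<forall>j. mat_norm P (e j) \<le> \<gamma> ^ j * mat_norm P (e 0)) \<and>
          (\<gamma> < 1 \<longrightarrow>
            (\<exists>K :: real \<Rightarrow> nat.
              (\<forall>\<epsilon>>0. \<forall>j \<ge> K \<epsilon>. mat_norm P (e j) \<le> \<epsilon>) \<and>
              (\<lambda>\<epsilon>. real (K \<epsilon>)) \<in> O[at_right 0](\<lambda>\<epsilon>. ln (1 / \<epsilon>) / ln (1 / \<gamma>)) \<and>
              (\<forall>C>1. \<forall>\<^sub>F \<epsilon> in at_right 0. real (K \<epsilon>) \<le> C * (ln (1 / \<epsilon>) / ln (1 / \<gamma>))))))))"
proof -
  define n where "n = dim_kkt G c"
  define J where "J = kkt_jacobian G c zk"
  define S where "S = kkt_sym G c zk"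
  define A where "A = kkt_skew G c zk"
  define b where "b = - kkt_residual G c zk"
  define T where "T = the (mat_inverse S)"
  have J: "J \<in> carrier_mat n n"
    unfolding J_def n_def kkt_jacobian_def by simp
  have S: "S \<in> carrier_mat n n" and A: "A \<in> carrier_mat n n"
    using J unfolding S_def A_def kkt_sym_def kkt_skew_def sym_part_def skew_part_def
      J_def[symmetric] by auto
  have J_split: "J = S + A"
    using sym_part_plus_skew_part[OF J] unfolding S_def A_def J_def kkt_sym_def kkt_skew_def by simp
  have b: "b \<in> carrier_vec n"
    unfolding b_def n_def using dim_kkt_residual[OF assms(1)] by (intro carrier_vecI) simp
  have "invertible_mat S" and rho: "real_spectral_radius (T * A) < \<gamma>"
    using assms(6) unfolding potential_dominant_def S_def A_def T_def by auto
  then have T: "T \<in> carrier_mat n n" "T * S = 1\<^sub>m n"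
    unfolding T_def using inverse_of_invertible_mat[OF S] by auto
  have TA: "T * A \<in> carrier_mat n n"
    using T A by simp
  obtain q where q: "0 < q" "real_spectral_radius (T * A) < q" "q < \<gamma>"
    using dense[of "max 0 (real_spectral_radius (T * A))" \<gamma>] assms(2) rho by auto
  \<comment> \<open>\<open>P\<close> comes from \<open>T * A\<close> alone, so it is available
    before the Newton step is known to exist and serves all initial vectors.\<close>
  obtain P where P: "pos_def_mat n P"
    and entry_le: "\<And>x i. x \<in> carrier_vec n \<Longrightarrow> i < n \<Longrightarrow> \<bar>x $ i\<bar> \<le> mat_norm P x"
    and contr: "\<And>x. x \<in> carrier_vec n \<Longrightarrow> mat_norm P ((T * A) *\<^sub>v x) \<le> q * mat_norm P x"
    using adapted_norm[OF TA q(1,2)] by blast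
  have P_carrier: "P \<in> carrier_mat n n"
    using P unfolding pos_def_mat_def by simp
  \<comment> \<open>The right-hand side \<open>r\<close> is left free: 0 serves for the kernel of
    \<open>J\<close>, and \<open>b\<close> for the refinement itself.\<close>
  have step: "mat_norm P (y - d) \<le> q * mat_norm P (x - d)"
    if "x \<in> carrier_vec n" "y \<in> carrier_vec n" "d \<in> carrier_vec n"
      "S *\<^sub>v y = r - A *\<^sub>v x" "J *\<^sub>v d = r" for x y d r
  proof -
    have "y - d = - ((T * A) *\<^sub>v (x - d))"
      using splitting_error_step[OF S A T that(1-4)] that(5) J_split by simp
    then show ?thesis
      using contr[of "x - d"] mat_norm_uminus[OF P_carrier, of "(T * A) *\<^sub>v (x - d)"] TA that
      by simp
  qed
  have norm_zero: "v = 0\<^sub>v n" if "v \<in> carrier_vec n" "mat_norm P v \<le> 0" for v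
    using entry_le[OF that(1)] that by (intro eq_vecI) (auto, fastforce)
  have "v = 0\<^sub>v n" if v: "v \<in> carrier_vec n" "J *\<^sub>v v = 0\<^sub>v n" for v
  proof (rule norm_zero[OF v(1)])
    \<comment> \<open>The constant sequence 0 is a refinement sequence for the right-hand side 0, and so is
      the constant sequence \<open>v\<close>: compare the two.\<close>
    have "S *\<^sub>v 0\<^sub>v n = 0\<^sub>v n - A *\<^sub>v 0\<^sub>v n"
      using S A by (intro eq_vecI) auto
    then have "mat_norm P (0\<^sub>v n - v) \<le> q * mat_norm P (0\<^sub>v n - v)"
      using step[of "0\<^sub>v n" "0\<^sub>v n" v "0\<^sub>v n"] v by simp
    moreover have "0\<^sub>v n - v = - v"
      using v by (intro eq_vecI) auto
    ultimately have "(1 - q) * mat_norm P v \<le> 0"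
      using mat_norm_uminus[OF P_carrier v(1)] by (simp add: algebra_simps)
    then show "mat_norm P v \<le> 0"
      using q assms(3) by (simp add: mult_le_0_iff)
  qed
  then have "\<exists>!d. newton_step G c zk d"
    using injective_mat_ex1_solution[OF J b]
    unfolding newton_step_def J_def b_def n_def by blast
  then obtain d where d: "newton_step G c zk d" "\<forall>d'. newton_step G c zk d' \<longrightarrow> d' = d"
    by auto
  have d_carrier: "d \<in> carrier_vec n" and Jd: "J *\<^sub>v d = b"
    using d(1) unfolding newton_step_def J_def b_def n_def by auto
  show ?thesis
  proof (intro exI[of _ d] conjI exI[of _ P] allI impI)
    show "newton_step G c zk d" "pos_def_mat (dim_kkt G c) P"
      using d(1) P unfolding n_def by auto
  next
    show "d' = d" if "newton_step G c zk d'" for d'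
      using d(2) that by blast
  next
    fix dz
    assume dz: "refinement_seq G c zk dz"
    define e where "e j = dz j - d" for j
    have dz_carrier: "dz j \<in> carrier_vec n" and dz_step: "S *\<^sub>v dz (Suc j) = b - A *\<^sub>v dz j" for j
      using dz unfolding refinement_seq_def n_def S_def A_def b_def by auto
    have e_carrier: "e j \<in> carrier_vec n" for j
      unfolding e_def using dz_carrier d_carrier by simp
    have e_step: "mat_norm P (e (Suc j)) \<le> q * mat_norm P (e j)" for j
      unfolding e_def by (rule step[OF dz_carrier dz_carrier d_carrier dz_step Jd])
    \<comment> \<open>Positive definiteness speaks only of nonzero vectors, hence the case split.
      The sign is needed to replace \<open>q ^ j\<close> by \<open>\<gamma> ^ j\<close> in front of
      the initial error.\<close>
    have e_nonneg: "0 \<le> mat_norm P (e j)" for j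
      using P e_carrier[of j] P_carrier unfolding pos_def_mat_def mat_norm_def
      by (cases "e j = 0\<^sub>v n") (auto intro: less_imp_le)
    have e_pow: "mat_norm P (e j) \<le> q ^ j * mat_norm P (e 0)" for j
    proof (induction j)
      case (Suc j)
      have "mat_norm P (e (Suc j)) \<le> q * (q ^ j * mat_norm P (e 0))"
        using e_step[of j] mult_left_mono[OF Suc, of q] q(1) by linarith
      then show ?case
        by (simp add: mult.assoc)
    qed simp
    have e_bound: "mat_norm P (e j) \<le> \<gamma> ^ j * mat_norm P (e 0)" for j
      using e_pow[of j] mult_right_mono[OF power_mono[of q \<gamma> j] e_nonneg[of 0]] q by linarith
    have "(\<lambda>j. q ^ j * mat_norm P (e 0)) \<longlonglongrightarrow> 0 * mat_norm P (e 0)"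
      using q assms(3) by (intro tendsto_intros LIMSEQ_power_zero) auto
    then have pow_lim: "(\<lambda>j. q ^ j * mat_norm P (e 0)) \<longlonglongrightarrow> 0"
      by simp
    have conv: "(\<lambda>j. dz j $ k) \<longlonglongrightarrow> d $ k" if k: "k < n" for k
    proof -
      have "norm (dz j $ k - d $ k) \<le> q ^ j * mat_norm P (e 0)" for j
        using entry_le[OF e_carrier k, of j] e_pow[of j] k d_carrier dz_carrier[of j]
        unfolding e_def by simp
      then have "(\<lambda>j. dz j $ k - d $ k) \<longlonglongrightarrow> 0"
        by (intro Lim_null_comparison[OF _ pow_lim] always_eventually allI)
      then show ?thesis
        by (rule LIM_zero_cancel)
    qed
    have rate: "linear_rate (mat_norm P) e"
      unfolding linear_rate_def using e_step q assms(3) by (intro exI[of _ q]) auto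
    have e_eq: "(\<lambda>j. dz j - d) = e"
      unfolding e_def by simp
    show "let e = (\<lambda>j. dz j - d) in
      (\<forall>k < dim_kkt G c. (\<lambda>j. dz j $ k) \<longlonglongrightarrow> d $ k) \<and>
      linear_rate (mat_norm P) e \<and>
      (\<forall>j. mat_norm P (e j) \<le> \<gamma> ^ j * mat_norm P (e 0)) \<and>
      (\<gamma> < 1 \<longrightarrow>
        (\<exists>K :: real \<Rightarrow> nat.
          (\<forall>\<epsilon>>0. \<forall>j \<ge> K \<epsilon>. mat_norm P (e j) \<le> \<epsilon>) \<and>
          (\<lambda>\<epsilon>. real (K \<epsilon>)) \<in> O[at_right 0](\<lambda>\<epsilon>. ln (1 / \<epsilon>) / ln (1 / \<gamma>)) \<and>
          (\<forall>C>1. \<forall>\<^sub>F \<epsilon> in at_right 0. real (K \<epsilon>) \<le> C * (ln (1 / \<epsilon>) / ln (1 / \<gamma>)))))"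
      unfolding Let_def e_eq
      \<comment> \<open>The count is applied with \<open>a\<close> the norm of the initial error, so
        \<open>K\<close> may depend on the sequence. The open premise is
        \<open>\<gamma> < 1\<close>, the guard of the last conjunct.\<close>
      using conv rate e_bound
        geometric_iteration_complexity[OF assms(2) _ e_bound]
      unfolding n_def by blast
  qed
qed

end
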